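(* Let $0\le\alpha\le1$, and let $\{a_k\}_{k\ge1}$ and $\{l_k\}_{k\ge1}$ be sequences of positive integers such that $l_k/a_k^\alpha\to\infty$ as $k\to\infty$. Let $\mathcal N\subseteq\mathbb Z_+$ be a set which, for some fixed positive integer $q$, contains each of the arithmetic progressions $$\{a_k,\ a_k+q,\ \dots,\ a_k+(l_k-1)q\},\qquad k\ge1.$$ Then there exists an increasing sequence $\{t_k\}_{k\ge1}\subseteq(0,1)$ such that the following holds: if $\Lambda=\{\lambda_k\}_{k\ge1}\subseteq\mathbb D$ satisfies $|\lambda_k|\ge t_k$ for all sufficiently large $k$, then $(\Lambda,\mathcal N)$ is not a uniqueness pair for $\mathcal D_\alpha$.
   Context: $\mathbb D=\{z\in\mathbb C:|z|<1\}$ and $\mathbb Z_+=\{0,1,2,\dots\}$. For an analytic function $f$ on $\mathbb D$, $\widehat f(k)$ denotes its $k$-th Taylor coefficient at $0$. For $0\le\alpha\le1$, the Dirichlet-type space $\mathcal D_\alpha$ is the Hilbert space of all analytic functions $f$ on $\mathbb D$ with $\|f\|_\alpha^2=\sum_{k\ge0}(k+1)^\alpha|\widehat f(k)|^2<\infty$. For $\Lambda\subseteq\mathbb D$ and $\mathcal N\subseteq\mathbb Z_+$, the pair $(\Lambda,\mathcal N)$ is a uniqueness pair for $\mathcal D_\alpha$ if the only $f\in\mathcal D_\alpha$ such that $f(\lambda)=0$ for all $\lambda\in\Lambda$ and $\widehat f(k)=0$ for all $k\in\mathbb Z_+\setminus\mathcal N$ is $f\equiv0$. *)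

theory Defs
  imports "HOL-Complex_Analysis.Complex_Analysis"
begin

text \<open>
  \<^term>\<open>fps_nth (fps_expansion f 0) k\<close> is \<^term>\<open>(deriv ^^ k) f 0 / fact k\<close>, the \<open>k\<close>-th Taylor
  coefficient of \<open>f\<close> at \<open>0\<close>. Functions are total on \<^typ>\<open>complex\<close>; only their values on the open
  unit disc matter, so ``\<open>f\<close> is identically zero'' means that it vanishes on that disc.
\<close>

abbreviation taylor_coeff :: "(complex \<Rightarrow> complex) \<Rightarrow> nat \<Rightarrow> complex" where
  "taylor_coeff f k \<equiv> fps_nth (fps_expansion f 0) k"

definition dirichlet_type_space :: "real \<Rightarrow> (complex \<Rightarrow> complex) set" where
  "dirichlet_type_space \<alpha> =
     {f. f analytic_on ball 0 1 \<and>
         summable (\<lambda>k. (real k + 1) powr \<alpha> * (cmod (taylor_coeff f k))\<^sup>2)}"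

definition uniqueness_pair :: "real \<Rightarrow> complex set \<Rightarrow> nat set \<Rightarrow> bool" where
  "uniqueness_pair \<alpha> \<Lambda> \<N> \<longleftrightarrow>
     (\<forall>f \<in> dirichlet_type_space \<alpha>.
        (\<forall>z\<in>\<Lambda>. f z = 0) \<and> (\<forall>k. k \<notin> \<N> \<longrightarrow> taylor_coeff f k = 0)
        \<longrightarrow> (\<forall>z \<in> ball 0 1. f z = 0))"

end

theory Submission
  imports Defs
begin

text \<open>
  Infinitely many \<open>a k\<close> lie in one residue class \<open>r\<close> modulo \<open>q\<close>, so one looks for
  \<open>f z = z ^ r * g (z ^ q)\<close>; this reduces the problem to \<open>q = 1\<close> with weights
  \<open>w m = (r + q * m + 1) powr \<alpha>\<close>. As \<open>\<Sum>j<l. 1 / w (m + j)\<close> over the \<open>k\<close>-th block is at least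
  a constant times \<open>ln (1 + l k / a k powr \<alpha>)\<close>, every tail of \<open>\<nat>\<close> contains blocks carrying
  polynomials of arbitrarily small norm which equal \<open>1\<close> at a given point close enough to the circle.
  The zeros are then imposed one at a time: a polynomial vanishing at the first \<open>n\<close> points is
  corrected by such a block polynomial times \<open>\<Prod>i<n. (z - \<nu> i)\<close>, supported beyond its degree, so
  that the corrected polynomial vanishes at \<open>\<nu> n\<close> as well. All sizes are bounded independently of
  the points, which is why the thresholds can be fixed beforehand. The finitely many points below
  the thresholds are put into the initial polynomial \<open>z ^ s * (\<Prod>i<N. (z - \<nu> i))\<close>.
\<close>

section \<open>Weighted square norms of polynomials\<close>

text \<open>This is the square of a weighted l2 norm, with no root taken. For
  \<open>w k = (k + 1) powr \<alpha>\<close> it is the squared norm of the Dirichlet-type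
  space.\<close>

definition wnorm :: "(nat \<Rightarrow> real) \<Rightarrow> complex poly \<Rightarrow> real" where
  "wnorm w p = (\<Sum>k\<le>degree p. w k * (cmod (coeff p k))\<^sup>2)"

lemma wnorm_eq:
  assumes "\<And>k. k > N \<Longrightarrow> coeff p k = 0"
  shows "wnorm w p = (\<Sum>k\<le>N. w k * (cmod (coeff p k))\<^sup>2)"
proof -
  have "degree p \<le> N" using assms by (intro degree_le) auto
  then show ?thesis unfolding wnorm_def
    by (intro sum.mono_neutral_left) (auto simp: coeff_eq_0)
qed

lemma wnorm_eq_lessThan:
  assumes "\<And>k. k \<ge> N \<Longrightarrow> coeff p k = 0"
  shows "wnorm w p = (\<Sum>k<N. w k * (cmod (coeff p k))\<^sup>2)"
proof -
  have "wnorm w p = (\<Sum>k\<le>N. w k * (cmod (coeff p k))\<^sup>2)"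
    using assms by (intro wnorm_eq) auto
  also have "\<dots> = (\<Sum>k<N. w k * (cmod (coeff p k))\<^sup>2)"
    using assms[of N] by (simp flip: lessThan_Suc_atMost)
  finally show ?thesis .
qed

lemma cmod_diff_power2_le: "(cmod (x - y))\<^sup>2 \<le> 2 * (cmod x)\<^sup>2 + 2 * (cmod y)\<^sup>2"
proof -
  have "(cmod (x - y))\<^sup>2 \<le> (cmod x + cmod y)\<^sup>2"
    by (intro power_mono norm_triangle_ineq4) auto
  also have "\<dots> \<le> 2 * (cmod x)\<^sup>2 + 2 * (cmod y)\<^sup>2"
    using sum_squares_bound[of "cmod x" "cmod y"] by (simp add: power2_sum)
  finally show ?thesis .
qed

text \<open>Multiplication by \<open>z - \<mu>\<close> is a shift minus \<open>\<mu>\<close> times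
  the identity. The shift costs a factor \<open>K\<close> by the growth condition on
  \<open>w\<close>, the other term a factor at most 1, and
  \<open>|x - y|^2 \<le> 2 |x|^2 + 2 |y|^2\<close> combines them uniformly in
  \<open>\<mu>\<close>.\<close>

lemma wnorm_mult_linear:
  assumes w: "\<And>k. 0 \<le> w k" "\<And>k. w (Suc k) \<le> K * w k" and \<mu>: "cmod \<mu> \<le> 1"
  shows "wnorm w ([:-\<mu>, 1:] * p) \<le> (2 * K + 2) * wnorm w p"
proof -
  define d where "d = degree p"
  have eq: "[:-\<mu>, 1:] * p = pCons 0 p - smult \<mu> p" by simp
  have "wnorm w ([:-\<mu>, 1:] * p) =
        (\<Sum>k\<le>Suc d. w k * (cmod (coeff (pCons 0 p) k - \<mu> * coeff p k))\<^sup>2)"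
    unfolding eq by (subst wnorm_eq[where N = "Suc d"])
      (auto simp: d_def coeff_pCons coeff_eq_0 split: nat.splits)
  also have "\<dots> \<le> (\<Sum>k\<le>Suc d. 2 * (w k * (cmod (coeff (pCons 0 p) k))\<^sup>2)
                             + 2 * (w k * (cmod (coeff p k))\<^sup>2))"
  proof (rule sum_mono)
    fix k
    have "(cmod (coeff (pCons 0 p) k - \<mu> * coeff p k))\<^sup>2
          \<le> 2 * (cmod (coeff (pCons 0 p) k))\<^sup>2 + 2 * (cmod (\<mu> * coeff p k))\<^sup>2"
      by (rule cmod_diff_power2_le)
    also have "(cmod (\<mu> * coeff p k))\<^sup>2 \<le> (cmod (coeff p k))\<^sup>2"
      using \<mu> by (intro power_mono) (auto simp: norm_mult mult_left_le_one_le)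
    finally have "w k * (cmod (coeff (pCons 0 p) k - \<mu> * coeff p k))\<^sup>2
       \<le> w k * (2 * (cmod (coeff (pCons 0 p) k))\<^sup>2 + 2 * (cmod (coeff p k))\<^sup>2)"
      using w(1) by (intro mult_left_mono) auto
    then show "w k * (cmod (coeff (pCons 0 p) k - \<mu> * coeff p k))\<^sup>2
       \<le> 2 * (w k * (cmod (coeff (pCons 0 p) k))\<^sup>2) + 2 * (w k * (cmod (coeff p k))\<^sup>2)"
      by (simp add: algebra_simps)
  qed
  also have "\<dots> = 2 * (\<Sum>k\<le>d. w (Suc k) * (cmod (coeff p k))\<^sup>2)
                  + 2 * (\<Sum>k\<le>Suc d. w k * (cmod (coeff p k))\<^sup>2)"
    by (simp only: sum.distrib sum_distrib_left[symmetric])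
      (subst (1) sum.atMost_Suc_shift, simp)
  also have "(\<Sum>k\<le>d. w (Suc k) * (cmod (coeff p k))\<^sup>2)
             \<le> (\<Sum>k\<le>d. K * w k * (cmod (coeff p k))\<^sup>2)"
    using w by (intro sum_mono mult_right_mono) auto
  also have "\<dots> = K * wnorm w p"
    by (simp add: wnorm_def d_def sum_distrib_left mult.assoc)
  also have "(\<Sum>k\<le>Suc d. w k * (cmod (coeff p k))\<^sup>2) = wnorm w p"
    by (subst wnorm_eq[where N = "Suc d"]) (auto simp: d_def coeff_eq_0)
  finally show ?thesis by (simp add: algebra_simps)
qed

lemma wnorm_mult_prod_linear:
  assumes w: "\<And>k. 0 \<le> w k" "\<And>k. w (Suc k) \<le> K * w k" and K: "0 \<le> K"
    and \<mu>: "\<And>i. i < n \<Longrightarrow> cmod (\<mu> i) \<le> 1"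
  shows "wnorm w ((\<Prod>i<n. [:-\<mu> i, 1:]) * p) \<le> (2 * K + 2) ^ n * wnorm w p"
  using \<mu>
proof (induction n)
  case (Suc n)
  have "wnorm w ((\<Prod>i<Suc n. [:-\<mu> i, 1:]) * p)
        = wnorm w ([:-\<mu> n, 1:] * ((\<Prod>i<n. [:-\<mu> i, 1:]) * p))"
    by (simp only: prod.lessThan_Suc mult_ac)
  also have "\<dots> \<le> (2 * K + 2) * wnorm w ((\<Prod>i<n. [:-\<mu> i, 1:]) * p)"
    using w Suc.prems by (intro wnorm_mult_linear) auto
  also have "\<dots> \<le> (2 * K + 2) * ((2 * K + 2) ^ n * wnorm w p)"
    using K Suc by (intro mult_left_mono) auto
  finally show ?case by (simp add: mult_ac)
qed auto

section \<open>Values, quotients and supports of polynomials\<close>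

lemma cmod_poly_le:
  assumes "\<And>k. cmod (coeff p k) \<le> B" and "cmod z \<le> 1"
  shows "cmod (poly p z) \<le> B * real (Suc (degree p))"
proof -
  have "cmod (poly p z) \<le> (\<Sum>k\<le>degree p. cmod (coeff p k * z ^ k))"
    unfolding poly_altdef by (rule norm_sum)
  also have "\<dots> \<le> (\<Sum>k\<le>degree p. B)"
  proof (rule sum_mono)
    fix k
    have "cmod (coeff p k * z ^ k) \<le> cmod (coeff p k) * 1"
      unfolding norm_mult norm_power using assms(2) by (intro mult_left_mono power_le_one) auto
    then show "cmod (coeff p k * z ^ k) \<le> B" using assms(1)[of k] by simp
  qed
  finally show ?thesis by (simp add: mult.commute)
qed

text \<open>By Horner's scheme each coefficient of the quotient is the value at \<open>z\<close> of
  a tail of \<open>p\<close>, so \<open>cmod_poly_le\<close> applies to it.\<close>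

lemma cmod_coeff_synthetic_div_le:
  assumes "\<And>k. cmod (coeff p k) \<le> B" and "cmod z \<le> 1"
  shows "cmod (coeff (synthetic_div p z) k) \<le> B * real (Suc (degree p))"
  using assms
proof (induction p arbitrary: k)
  case 0
  then show ?case by (simp add: order_trans[OF norm_ge_zero])
next
  case (pCons a p)
  have B: "cmod (coeff p j) \<le> B" for j
    using pCons.prems(1)[of "Suc j"] by simp
  have B0: "0 \<le> B" using B[of 0] by (meson norm_ge_zero order_trans)
  have deg: "degree p \<le> degree (pCons a p)"
    by (simp add: degree_pCons_eq_if)
  have *: "B * real (Suc (degree p)) \<le> B * real (Suc (degree (pCons a p)))"
    using B0 deg by (intro mult_left_mono) auto
  show ?case
  proof (cases k)
    case 0
    then show ?thesis using cmod_poly_le[OF B pCons.prems(2)] * by simp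
  next
    case (Suc j)
    then show ?thesis using pCons.IH[OF B pCons.prems(2), of j] * by simp
  qed
qed

text \<open>Bernoulli's inequality. A point this close to the circle behaves, up to a factor 2, like
  a boundary point for all powers up to \<open>e\<close>.\<close>

lemma half_le_power:
  fixes x :: real
  assumes "0 < e" and "1 - 1 / (2 * real e) \<le> x" and "x \<le> 1" and "m \<le> e"
  shows "1 / 2 \<le> x ^ m"
proof -
  have b: "-1 \<le> - 1 / (2 * real e)" using assms(1) by (simp add: field_simps)
  have "1 / 2 = 1 + real e * (- 1 / (2 * real e))" using assms(1) by (simp add: field_simps)
  also have "\<dots> \<le> (1 + (- 1 / (2 * real e))) ^ e" by (rule Bernoulli_inequality[OF b])
  also have "\<dots> \<le> x ^ e" using assms(1,2) by (intro power_mono) (auto simp: field_simps)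
  also have "\<dots> \<le> x ^ m"
  proof (rule power_decreasing[OF assms(4) _ assms(3)])
    have "0 \<le> 1 - 1 / (2 * real e)" using assms(1) by (simp add: field_simps)
    then show "0 \<le> x" using assms(2) by linarith
  qed
  finally show ?thesis .
qed

lemma coeff_mult_nonzero_range:
  assumes "degree P \<le> n" and "\<And>k. coeff H k \<noteq> 0 \<Longrightarrow> s \<le> k \<and> k < d" and "coeff (P * H) k \<noteq> 0"
  shows "s \<le> k \<and> k < d + n"
proof -
  have "\<exists>i\<in>{..k}. coeff P i * coeff H (k - i) \<noteq> 0"
    using assms(3) unfolding coeff_mult by (meson sum.neutral)
  then obtain i where i: "i \<le> k" "coeff P i \<noteq> 0" "coeff H (k - i) \<noteq> 0"
    by (metis atMost_iff mult_zero_left mult_zero_right)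
  have "i \<le> n" using i(2) assms(1) by (meson le_degree order_trans)
  then show ?thesis using i(1) assms(2)[OF i(3)] by linarith
qed

lemma degree_prod_linear: "degree (\<Prod>i<n. [:- (\<mu> i :: complex), 1:]) = n"
  by (subst degree_prod_eq_sum_degree) auto

lemma lead_coeff_prod_linear: "lead_coeff (\<Prod>i<n. [:- (\<mu> i :: complex), 1:]) = 1"
  by (simp add: lead_coeff_prod)

lemma poly_eq_sum_lessThan:
  fixes p :: "'a::comm_semiring_1 poly"
  assumes "\<And>k. k \<ge> n \<Longrightarrow> coeff p k = 0"
  shows "poly p z = (\<Sum>k<n. coeff p k * z ^ k)"
proof -
  have "(\<Sum>k\<le>degree p. coeff p k * z ^ k) = (\<Sum>k<n. coeff p k * z ^ k)"
  proof (rule sum.mono_neutral_cong)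
    show "coeff p k * z ^ k = 0" if "k \<in> {..<n} - {..degree p}" for k
      using that by (simp add: coeff_eq_0)
    show "coeff p k * z ^ k = 0" if "k \<in> {..degree p} - {..<n}" for k
      using that assms[of k] by simp
  qed auto
  then show ?thesis by (simp add: poly_altdef)
qed

section \<open>From successive corrections to a power series\<close>

lemma glue_polynomials:
  fixes g G :: "nat \<Rightarrow> complex poly" and d :: "nat \<Rightarrow> nat"
  assumes d: "strict_mono d" and w: "\<And>k. 0 \<le> w k"
    and g: "\<And>i k. coeff (g i) k \<noteq> 0 \<Longrightarrow> k \<in> S \<inter> {..<d i}"
    and g_Suc: "\<And>i. g (Suc i) = g i - G i"
    and G: "\<And>i k. coeff (G i) k \<noteq> 0 \<Longrightarrow> k \<in> {d i..<d (Suc i)}"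
    and G_le: "\<And>i. wnorm w (G i) \<le> (1 / 2) ^ i"
  obtains c where "\<And>k. c k \<noteq> 0 \<Longrightarrow> k \<in> S" and "summable (\<lambda>k. w k * (cmod (c k))\<^sup>2)"
    and "\<And>i k. k < d i \<Longrightarrow> c k = coeff (g i) k"
    and "\<And>i z. (\<Sum>k<d i. c k * z ^ k) = poly (g i) z"
proof
  \<comment> \<open>Stage \<open>Suc k\<close> is late enough: strict monotonicity gives
    \<open>Suc k \<le> d (Suc k)\<close>, so coefficient \<open>k\<close> is already frozen.\<close>
  define c where "c k = coeff (g (Suc k)) k" for k
  have stable: "coeff (g j) k = coeff (g i) k" if "i \<le> j" "k < d i" for i j k
    using that(1)
  proof (induction j rule: dec_induct)
    case (step j)
    have "d i \<le> d j" using step.hyps d by (simp add: strict_mono_less_eq)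
    then have "coeff (G j) k = 0" using G[of j k] that(2) by auto
    then show ?case using step.IH by (simp add: g_Suc)
  qed simp
  show c: "c k = coeff (g i) k" if "k < d i" for i k
  proof (cases "i \<le> Suc k")
    case True
    then show ?thesis unfolding c_def using that by (intro stable)
  next
    case False
    have "k < d (Suc k)"
      using strict_mono_imp_increasing[OF d, of "Suc k"] by simp
    then show ?thesis unfolding c_def using False by (intro stable[symmetric]) auto
  qed
  show "k \<in> S" if "c k \<noteq> 0" for k
    using g[of "Suc k" k] that by (simp add: c_def)
  show "(\<Sum>k<d i. c k * z ^ k) = poly (g i) z" for i z
  proof -
    have "coeff (g i) k = 0" if "d i \<le> k" for k using g[of i k] that by auto
    then show ?thesis by (subst poly_eq_sum_lessThan[of "d i"]) (auto simp: c)
  qed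
  define u where "u k = w k * (cmod (c k))\<^sup>2" for k
  have u0: "0 \<le> u k" for k using w by (simp add: u_def)
  have step: "sum u {d i..<d (Suc i)} \<le> (1 / 2) ^ i" for i
  proof -
    have "sum u {d i..<d (Suc i)} = (\<Sum>k\<in>{d i..<d (Suc i)}. w k * (cmod (coeff (G i) k))\<^sup>2)"
    proof (rule sum.cong)
      fix k assume k: "k \<in> {d i..<d (Suc i)}"
      have "coeff (g i) k = 0" using g[of i k] k by auto
      then show "u k = w k * (cmod (coeff (G i) k))\<^sup>2"
        using k c[of k "Suc i"] by (simp add: u_def g_Suc)
    qed simp
    also have "\<dots> \<le> (\<Sum>k<d (Suc i). w k * (cmod (coeff (G i) k))\<^sup>2)"
      using w by (intro sum_mono2) auto
    also have "\<dots> = wnorm w (G i)"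
    proof (rule wnorm_eq_lessThan[symmetric])
      show "coeff (G i) k = 0" if "d (Suc i) \<le> k" for k using G[of i k] that by auto
    qed
    finally show ?thesis using G_le[of i] by linarith
  qed
  \<comment> \<open>\<open>2 - 2 * (1 / 2) ^ i\<close> is the sum of the first \<open>i\<close>
    terms of the geometric series.\<close>
  have bound: "sum u {..<d i} \<le> sum u {..<d 0} + (2 - 2 * (1 / 2) ^ i)" for i
  proof (induction i)
    case (Suc i)
    have "d i \<le> d (Suc i)" using d by (simp add: strict_mono_less_eq)
    then have "sum u {..<d (Suc i)} = sum u {..<d i} + sum u {d i..<d (Suc i)}"
      using sum.atLeastLessThan_concat[of 0 "d i" "d (Suc i)" u] by (simp add: atLeast0LessThan)
    then show ?case using Suc step[of i] by simp
  qed simp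
  show "summable (\<lambda>k. w k * (cmod (c k))\<^sup>2)"
    unfolding u_def[symmetric]
  proof (rule summableI_nonneg_bounded[OF u0])
    fix n
    have "sum u {..<n} \<le> sum u {..<d n}"
      using strict_mono_imp_increasing[OF d, of n] u0 by (intro sum_mono2) auto
    also have "\<dots> \<le> sum u {..<d 0} + 2"
      using bound[of n] by (smt (verit) zero_le_power divide_nonneg_nonneg)
    finally show "sum u {..<n} \<le> sum u {..<d 0} + 2" .
  qed
qed

text \<open>The terms are dominated via \<open>2 x y \<le> x^2 + y^2\<close>, which splits them into
  the weighted squares and a geometric series.\<close>

lemma summable_power_series_of_square_summable:
  fixes c :: "nat \<Rightarrow> complex"
  assumes "summable (\<lambda>k. w k * (cmod (c k))\<^sup>2)" and "\<And>k. 1 \<le> w k" and "cmod z < 1"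
  shows "summable (\<lambda>k. c k * z ^ k)"
proof (rule summable_comparison_test')
  have "(cmod z)\<^sup>2 < 1" using assms(3) by (simp add: abs_square_less_1)
  then show "summable (\<lambda>k. w k * (cmod (c k))\<^sup>2 + ((cmod z)\<^sup>2) ^ k)"
    by (intro summable_add assms(1) summable_geometric) simp
  fix k
  have "2 * (cmod (c k) * cmod z ^ k) \<le> (cmod (c k))\<^sup>2 + (cmod z ^ k)\<^sup>2"
    using sum_squares_bound[of "cmod (c k)" "cmod z ^ k"] by simp
  moreover have "0 \<le> cmod (c k) * cmod z ^ k" by simp
  moreover have "(cmod (c k))\<^sup>2 \<le> w k * (cmod (c k))\<^sup>2"
    using assms(2)[of k] mult_right_mono[of 1 "w k" "(cmod (c k))\<^sup>2"] by simp
  moreover have "(cmod z ^ k)\<^sup>2 = ((cmod z)\<^sup>2) ^ k" by (simp add: power_mult[symmetric] mult.commute)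
  ultimately have "cmod (c k) * cmod z ^ k \<le> w k * (cmod (c k))\<^sup>2 + ((cmod z)\<^sup>2) ^ k"
    by linarith
  then show "norm (c k * z ^ k) \<le> w k * (cmod (c k))\<^sup>2 + ((cmod z)\<^sup>2) ^ k"
    by (simp add: norm_mult norm_power)
qed

section \<open>Absorbing zeros one at a time in blocks\<close>

text \<open>This is the case \<open>q = 1\<close> with general weights. By Cauchy-Schwarz, the least
  \<open>wnorm\<close> of a polynomial supported in \<open>{s..<e}\<close> with value 1 at a given
  point of the circle is the reciprocal of the sum of \<open>1 / w m\<close>, so
  \<open>blocks\<close> yields arbitrarily cheap peaks arbitrarily far out.\<close>

locale divergent_blocks =
  fixes w :: "nat \<Rightarrow> real" and K :: real and S :: "nat set"
  assumes w_ge1: "1 \<le> w k"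
    and w_Suc: "w (Suc k) \<le> K * w k"
    and blocks: "\<exists>s e. D \<le> s \<and> {s..<e} \<subseteq> S \<and> M \<le> (\<Sum>m\<in>{s..<e}. 1 / w m)"
begin

lemma w_pos: "0 < w k"
  using w_ge1[of k] by linarith

lemma K_nonneg: "0 \<le> K"
  using w_Suc[of 0] w_pos[of 0] w_pos[of 1] by (smt (verit) One_nat_def zero_le_mult_iff)

lemma inverse_w_le1: "1 / w k \<le> 1"
  using w_ge1[of k] by simp

definition block_sum :: "nat \<Rightarrow> nat \<Rightarrow> real" where
  "block_sum s e = (\<Sum>m\<in>{s..<e}. 1 / w m)"

lemma block_sum_le: "block_sum s e \<le> real (e - s)"
proof -
  have "block_sum s e \<le> (\<Sum>m\<in>{s..<e}. 1)"
    unfolding block_sum_def by (intro sum_mono inverse_w_le1)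
  then show ?thesis by simp
qed

text \<open>The phases of the coefficients are chosen so that no cancellation occurs at \<open>\<nu>\<close>; the moduli
  \<open>1 / w m\<close> minimise the weighted norm for a prescribed value at a boundary point.\<close>

definition peak_poly :: "complex \<Rightarrow> nat \<Rightarrow> nat \<Rightarrow> complex poly" where
  "peak_poly \<nu> s d = (\<Sum>m\<in>{s..<d}. monom (of_real (1 / w m) * (cnj \<nu> / cmod \<nu>) ^ m) m)"

lemma coeff_peak_poly:
  "coeff (peak_poly \<nu> s d) k =
    (if k \<in> {s..<d} then of_real (1 / w k) * (cnj \<nu> / cmod \<nu>) ^ k else 0)"
  unfolding peak_poly_def by (simp add: coeff_sum)

lemma cmod_coeff_peak_poly:
  assumes "\<nu> \<noteq> 0"
  shows "cmod (coeff (peak_poly \<nu> s d) k) = (if k \<in> {s..<d} then 1 / w k else 0)"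
  using assms w_pos[of k]
  by (auto simp: coeff_peak_poly norm_mult norm_power norm_divide)

lemma wnorm_peak_poly:
  assumes "\<nu> \<noteq> 0"
  shows "wnorm w (peak_poly \<nu> s d) = block_sum s d"
proof -
  have "wnorm w (peak_poly \<nu> s d) = (\<Sum>k<d. w k * (cmod (coeff (peak_poly \<nu> s d) k))\<^sup>2)"
    by (rule wnorm_eq_lessThan) (simp add: coeff_peak_poly)
  also have "\<dots> = (\<Sum>k\<in>{s..<d}. 1 / w k)"
  proof (rule sum.mono_neutral_cong_right)
    show "w k * (cmod (coeff (peak_poly \<nu> s d) k))\<^sup>2 = 1 / w k" if "k \<in> {s..<d}" for k
      using that w_pos[of k] cmod_coeff_peak_poly[OF assms, of s d k]
      by (simp add: power2_eq_square)
  qed (auto simp: coeff_peak_poly)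
  finally show ?thesis by (simp add: block_sum_def)
qed

lemma poly_peak_poly_ge:
  assumes "\<nu> \<noteq> 0" and "\<And>m. m < d \<Longrightarrow> 1 / 2 \<le> cmod \<nu> ^ m"
  shows "block_sum s d / 2 \<le> cmod (poly (peak_poly \<nu> s d) \<nu>)"
proof -
  have unit: "cnj \<nu> / cmod \<nu> * \<nu> = of_real (cmod \<nu>)"
    using assms(1) by (simp add: complex_norm_square[symmetric] power2_eq_square mult.commute)
  have "poly (peak_poly \<nu> s d) \<nu> = (\<Sum>m\<in>{s..<d}. of_real (1 / w m) * ((cnj \<nu> / cmod \<nu>) ^ m * \<nu> ^ m))"
    unfolding peak_poly_def by (simp add: poly_sum poly_monom mult.assoc)
  also have "\<dots> = of_real (\<Sum>m\<in>{s..<d}. 1 / w m * cmod \<nu> ^ m)"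
    by (simp only: power_mult_distrib[symmetric] unit of_real_sum of_real_mult of_real_power)
  finally have eq: "poly (peak_poly \<nu> s d) \<nu> = of_real (\<Sum>m\<in>{s..<d}. 1 / w m * cmod \<nu> ^ m)" .
  have "block_sum s d / 2 = (\<Sum>m\<in>{s..<d}. 1 / w m * (1 / 2))"
    by (simp add: block_sum_def sum_divide_distrib)
  also have "\<dots> \<le> (\<Sum>m\<in>{s..<d}. 1 / w m * cmod \<nu> ^ m)"
    using assms(2) w_pos by (intro sum_mono mult_left_mono) (auto simp: less_imp_le)
  also have "\<dots> \<le> cmod (poly (peak_poly \<nu> s d) \<nu>)"
    unfolding eq by (simp only: norm_of_real abs_ge_self)
  finally show ?thesis .
qed

text \<open>\<open>F\<close> is the cofactor left once the zeros \<open>\<mu> i\<close> are split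
  off; subtracting \<open>H\<close> makes it divisible by \<open>z - \<nu>\<close>, with
  \<open>F'\<close> as the next cofactor. Degree and coefficient bounds concern the cofactors, while
  support and norm concern the full product with \<open>H\<close>, which is what is subtracted from
  the polynomial itself.\<close>

definition absorbs_zero :: "nat \<Rightarrow> real \<Rightarrow> nat \<Rightarrow> real \<Rightarrow> nat \<Rightarrow> real \<Rightarrow> real \<Rightarrow> bool" where
  "absorbs_zero n \<epsilon> D B D' B' \<tau> \<longleftrightarrow>
    (\<forall>\<mu> F \<nu>. (\<forall>i<n. cmod (\<mu> i) \<le> 1) \<longrightarrow> degree F < D \<longrightarrow> (\<forall>k. cmod (coeff F k) \<le> B) \<longrightarrow>
       \<tau> \<le> cmod \<nu> \<longrightarrow> cmod \<nu> < 1 \<longrightarrow>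
       (\<exists>F' H. F = [:-\<nu>, 1:] * F' + H \<and> degree F' < D' \<and> (\<forall>k. cmod (coeff F' k) \<le> B') \<and>
         (\<forall>k. coeff ((\<Prod>i<n. [:-\<mu> i, 1:]) * H) k \<noteq> 0 \<longrightarrow> k \<in> S \<inter> {D..<D'}) \<and>
         wnorm w ((\<Prod>i<n. [:-\<mu> i, 1:]) * H) \<le> \<epsilon>))"

text \<open>The point is that \<open>D'\<close>, \<open>B'\<close> and \<open>\<tau>\<close> depend only on \<open>n\<close>, \<open>D\<close>, \<open>B\<close> and \<open>\<epsilon>\<close>, not on the zeros:
  factoring out \<open>\<Prod>i<n. [:- \<mu> i, 1:]\<close> makes the estimates insensitive to (nearly) coinciding
  zeros.\<close>

lemma absorbs_zero_exists:
  assumes "0 < \<epsilon>" and "0 \<le> B"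
  shows "\<exists>D' B' \<tau>. D < D' \<and> 1 \<le> B' \<and> \<tau> \<in> {0<..<1} \<and> (\<exists>s. {s..s + Suc n} \<subseteq> S \<inter> {..<D'}) \<and>
    absorbs_zero n \<epsilon> D B D' B' \<tau>"
proof -
  define C where "C = (2 * K + 2) ^ n"
  have C: "0 \<le> C" using K_nonneg by (simp add: C_def)
  \<comment> \<open>The final estimate is \<open>4 * C * (B * real D)\<^sup>2 / T\<close>, which is
    at most \<open>\<epsilon>\<close> once \<open>T \<ge> A\<close>.\<close>
  define A where "A = 4 * C * (B * real D)\<^sup>2 / \<epsilon>"
  have A: "0 \<le> A" using C assms(1) by (simp add: A_def)
  \<comment> \<open>Of the required sum, \<open>n\<close> pays for the indices cut off below and
    \<open>2\<close> ensures \<open>T \<ge> 2\<close>, hence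
    \<open>cmod c \<le> B * real D\<close>.\<close>
  obtain s e where se: "D \<le> s" "{s..<e} \<subseteq> S" "real n + 2 + A \<le> block_sum s e"
    using blocks[of D "real n + 2 + A"] unfolding block_sum_def by blast
  have "real n + 2 \<le> real (e - s)" using se(3) A block_sum_le[of s e] by linarith
  then have es: "s + n + 2 \<le> e" by linarith
  \<comment> \<open>The last \<open>n\<close> indices of the block stay free for the degree
    \<open>n\<close> of the product of linear factors. They carry at most \<open>n\<close> of the
    block sum since \<open>1 / w m \<le> 1\<close>.\<close>
  define d where "d = e - n"
  have d: "s + 2 \<le> d" "e = d + n" using es by (auto simp: d_def)
  define T where "T = block_sum s d"
  have "block_sum s e = T + block_sum d e"
    unfolding block_sum_def T_def using d by (intro sum.atLeastLessThan_concat[symmetric]) auto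
  then have T: "2 + A \<le> T" using se(3) block_sum_le[of d e] d(2) by simp
  define \<tau> where "\<tau> = 1 - 1 / (2 * real e)"
  have e0: "0 < e" using d by simp
  have \<tau>: "0 < \<tau>" "\<tau> < 1" using e0 by (auto simp: \<tau>_def field_simps)
  \<comment> \<open>\<open>B + B * real D\<close> bounds the coefficients of \<open>F - H\<close>,
    and synthetic division costs at most a factor \<open>e\<close>. The summand 1 gives
    \<open>B' \<ge> 1\<close>, so that a later construction may start from a monomial with
    coefficient 1.\<close>
  define B' where "B' = (B + B * real D) * real e + 1"
  have B'1: "1 \<le> B'" using assms(2) by (simp add: B'_def)
  have "\<exists>F' H. F = [:-\<nu>, 1:] * F' + H \<and> degree F' < e \<and> (\<forall>k. cmod (coeff F' k) \<le> B') \<and>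
         (\<forall>k. coeff ((\<Prod>i<n. [:-\<mu> i, 1:]) * H) k \<noteq> 0 \<longrightarrow> k \<in> S \<inter> {D..<e}) \<and>
         wnorm w ((\<Prod>i<n. [:-\<mu> i, 1:]) * H) \<le> \<epsilon>"
    if \<mu>: "\<forall>i<n. cmod (\<mu> i) \<le> 1" and F: "degree F < D" "\<forall>k. cmod (coeff F k) \<le> B"
      and \<nu>: "\<tau> \<le> cmod \<nu>" "cmod \<nu> < 1" for \<mu> F \<nu>
  proof -
    have \<nu>0: "\<nu> \<noteq> 0" using \<nu>(1) \<tau>(1) by auto
    define H0 where "H0 = peak_poly \<nu> s d"
    have H0: "T / 2 \<le> cmod (poly H0 \<nu>)"
      unfolding T_def H0_def
    proof (rule poly_peak_poly_ge[OF \<nu>0])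
      show "1 / 2 \<le> cmod \<nu> ^ m" if "m < d" for m
        using that d(2) \<nu> e0 by (intro half_le_power[where e = e]) (auto simp: \<tau>_def)
    qed
    define c where "c = poly F \<nu> / poly H0 \<nu>"
    have H0nz: "poly H0 \<nu> \<noteq> 0" using H0 T A by auto
    have "cmod (poly F \<nu>) \<le> B * real (Suc (degree F))"
      using F(2) \<nu>(2) by (intro cmod_poly_le) auto
    also have "\<dots> \<le> B * real D" using F(1) assms(2) by (intro mult_left_mono) auto
    finally have PF: "cmod (poly F \<nu>) \<le> B * real D" .
    have "cmod c \<le> (B * real D) / (T / 2)"
      unfolding c_def norm_divide using PF H0 T A assms(2) by (intro frac_le) auto
    then have c: "cmod c \<le> 2 * (B * real D) / T" by (simp add: field_simps)
    also have "\<dots> \<le> B * real D"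
      using T A assms(2) mult_left_mono[of 2 T "B * real D"] by (simp add: divide_le_eq mult.commute)
    finally have c': "cmod c \<le> B * real D" .
    define H where "H = smult c H0"
    have coH: "s \<le> k \<and> k < d" if "coeff H k \<noteq> 0" for k
      using that by (simp add: H_def H0_def coeff_peak_poly split: if_splits)
    have coH_le: "cmod (coeff H k) \<le> B * real D" for k
    proof -
      have "cmod (coeff H0 k) \<le> 1"
        unfolding H0_def cmod_coeff_peak_poly[OF \<nu>0] using inverse_w_le1[of k] by simp
      then have "cmod (coeff H k) \<le> cmod c * 1"
        unfolding H_def coeff_smult norm_mult by (intro mult_left_mono) auto
      then show ?thesis using c' by simp
    qed
    define F' where "F' = synthetic_div (F - H) \<nu>"
    have "poly (F - H) \<nu> = 0" using H0nz by (simp add: H_def c_def)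
    then have "F - H = [:-\<nu>, 1:] * F'"
      using synthetic_div_correct'[of \<nu> "F - H"] by (simp add: F'_def)
    then have FH: "F = [:-\<nu>, 1:] * F' + H" by (metis diff_add_cancel)
    have "degree (F - H) \<le> e - 1"
    proof (rule degree_le, intro allI impI)
      fix i assume "e - 1 < i"
      then have "d \<le> i" "degree F < i" using F(1) se(1) d by auto
      then show "coeff (F - H) i = 0" using coH[of i] by (auto simp: coeff_eq_0)
    qed
    then have degFH: "Suc (degree (F - H)) \<le> e" using e0 by simp
    have "cmod (coeff (F - H) k) \<le> B + B * real D" for k
      using F(2) coH_le[of k] norm_triangle_ineq4[of "coeff F k" "coeff H k"]
      by (auto intro: order_trans add_mono)
    then have "cmod (coeff F' k) \<le> (B + B * real D) * real (Suc (degree (F - H)))" for k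
      unfolding F'_def using \<nu>(2) by (intro cmod_coeff_synthetic_div_le) auto
    also have "(B + B * real D) * real (Suc (degree (F - H))) \<le> (B + B * real D) * real e"
      using degFH assms(2) by (intro mult_left_mono) auto
    finally have "cmod (coeff F' k) \<le> B'" for k unfolding B'_def by (simp add: add_increasing2)
    moreover have "degree F' < e" using degFH by (simp add: F'_def degree_synthetic_div)
    moreover have "k \<in> S \<inter> {D..<e}" if "coeff ((\<Prod>i<n. [:-\<mu> i, 1:]) * H) k \<noteq> 0" for k
      using coeff_mult_nonzero_range[OF _ coH that, of n] d(2) se(1,2)
      by (auto simp: degree_prod_linear)
    moreover have "wnorm w ((\<Prod>i<n. [:-\<mu> i, 1:]) * H) \<le> \<epsilon>"
    proof -
      have "wnorm w ((\<Prod>i<n. [:-\<mu> i, 1:]) * H) \<le> C * wnorm w H"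
        unfolding C_def using \<mu> w_pos w_Suc K_nonneg
        by (intro wnorm_mult_prod_linear) (auto simp: less_imp_le)
      also have "wnorm w H = (cmod c)\<^sup>2 * T"
      \<comment> \<open>\<open>wnorm\<close> sums up to the degree, which \<open>smult c\<close>
        preserves only for nonzero \<open>c\<close>.\<close>
      proof (cases "c = 0")
        case False
        then have "wnorm w H = (cmod c)\<^sup>2 * wnorm w H0"
          by (simp add: wnorm_def H_def norm_mult power_mult_distrib sum_distrib_left mult_ac)
        then show ?thesis by (simp add: H0_def T_def wnorm_peak_poly[OF \<nu>0])
      qed (simp add: H_def wnorm_def)
      also have "C * ((cmod c)\<^sup>2 * T) \<le> C * ((2 * (B * real D) / T)\<^sup>2 * T)"
        using C c T A by (intro mult_left_mono mult_right_mono power_mono) auto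
      also have "\<dots> = 4 * C * (B * real D)\<^sup>2 / T"
        using T A by (simp add: power2_eq_square field_simps)
      also have "\<dots> \<le> \<epsilon>"
      proof -
        have "4 * C * (B * real D)\<^sup>2 = A * \<epsilon>" using assms(1) by (simp add: A_def)
        also have "\<dots> \<le> T * \<epsilon>" using T assms(1) by (intro mult_right_mono) auto
        finally show ?thesis using T A by (simp add: divide_le_eq mult.commute)
      qed
      finally show ?thesis .
    qed
    ultimately show ?thesis using FH by blast
  qed
  moreover have "\<exists>s. {s..s + Suc n} \<subseteq> S \<inter> {..<e}"
  proof (intro exI)
    show "{s..s + Suc n} \<subseteq> S \<inter> {..<e}" using se(2) es by auto
  qed
  moreover have "D < e" using se(1) es by simp
  ultimately show ?thesis using \<tau> B'1 unfolding absorbs_zero_def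
    by (intro exI[of _ e] exI[of _ B'] exI[of _ \<tau>]) auto
qed

text \<open>The bounds produced by one step are the input of the next, so the recursion never refers
  to the points. The interval \<open>{s..s + n}\<close> is room below \<open>D n\<close> for an
  initial polynomial with \<open>n\<close> prescribed zeros.\<close>

lemma thresholds_exist:
  obtains D :: "nat \<Rightarrow> nat" and B \<tau> :: "nat \<Rightarrow> real" where "strict_mono D" and "\<And>n. 1 \<le> B n"
    and "\<And>n. \<tau> n \<in> {0<..<1}" and "\<And>n. \<exists>s. {s..s + n} \<subseteq> S \<inter> {..<D n}"
    and "\<And>n. absorbs_zero n ((1 / 2) ^ n) (D n) (B n) (D (Suc n)) (B (Suc n)) (\<tau> n)"
proof -
  define P where "P n x \<longleftrightarrow> (case x of (D, B, \<tau>) \<Rightarrow>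
      1 \<le> B \<and> \<tau> \<in> {0<..<1} \<and> (\<exists>s. {s..s + n} \<subseteq> S \<inter> {..<D}))"
    for n and x :: "nat \<times> real \<times> real"
  define Q where "Q n x y \<longleftrightarrow> (case x of (D, B, _) \<Rightarrow> case y of (D', B', \<tau>) \<Rightarrow>
      D < D' \<and> absorbs_zero n ((1 / 2) ^ n) D B D' B' \<tau>)"
    for n and x y :: "nat \<times> real \<times> real"
  have "\<exists>X. \<forall>n. P n (X n) \<and> Q n (X n) (X (Suc n))"
  proof (rule dependent_nat_choice)
    obtain s e where se: "{s..<e} \<subseteq> S" "1 \<le> block_sum s e"
      using blocks[of 0 1] unfolding block_sum_def by blast
    then have "s < e" using block_sum_le[of s e] by linarith
    then have "{s..s + 0} \<subseteq> S \<inter> {..<e}" using se(1) by auto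
    \<comment> \<open>The \<open>1 / 2\<close> is a default value: the threshold of step
      \<open>n\<close> is stored in entry \<open>Suc n\<close>, hence the shift of
      \<open>\<tau>\<close> at the end.\<close>
    then have "P 0 (e, 1, 1 / 2)" unfolding P_def prod.case by (intro conjI exI[of _ s]) auto
    then show "\<exists>x. P 0 x" ..
    show "\<exists>y. P (Suc n) y \<and> Q n x y" if "P n x" for x n
    proof -
      obtain D B \<tau> where x: "x = (D, B, \<tau>)" by (cases x)
      have "1 \<le> B" using that by (simp add: x P_def)
      then obtain D' B' \<tau>' where "D < D'" "1 \<le> B'" "\<tau>' \<in> {0<..<1}"
        "\<exists>s. {s..s + Suc n} \<subseteq> S \<inter> {..<D'}" "absorbs_zero n ((1 / 2) ^ n) D B D' B' \<tau>'"
        using absorbs_zero_exists[of "(1 / 2) ^ n" B D n] by auto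
      then have "P (Suc n) (D', B', \<tau>') \<and> Q n x (D', B', \<tau>')"
        unfolding P_def Q_def x prod.case by blast
      then show ?thesis ..
    qed
  qed
  then obtain X where X: "P n (X n)" "Q n (X n) (X (Suc n))" for n by blast
  define D where "D n = fst (X n)" for n
  define B where "B n = fst (snd (X n))" for n
  define \<tau> where "\<tau> n = snd (snd (X n))" for n
  have Xn: "X n = (D n, B n, \<tau> n)" for n by (simp add: D_def B_def \<tau>_def)
  have P: "1 \<le> B n" "\<tau> n \<in> {0<..<1}" "\<exists>s. {s..s + n} \<subseteq> S \<inter> {..<D n}" for n
    using X(1)[of n] unfolding P_def Xn prod.case by blast+
  have Q: "D n < D (Suc n)"
    "absorbs_zero n ((1 / 2) ^ n) (D n) (B n) (D (Suc n)) (B (Suc n)) (\<tau> (Suc n))" for n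
    using X(2)[of n] unfolding Q_def Xn prod.case by blast+
  show ?thesis
    by (rule that[of D B "\<lambda>n. \<tau> (Suc n)"]) (use P Q in \<open>auto simp: strict_mono_Suc_iff\<close>)
qed

text \<open>The polynomials are \<open>P (N + i) * F i\<close>, where \<open>N\<close> is an index
  from which the points respect the thresholds. The partial sums of \<open>c\<close> up to the
  cut-offs \<open>d i\<close> are exactly these polynomials.\<close>

lemma nonzero_power_series_with_zeros:
  "\<exists>\<tau>. (\<forall>n. \<tau> n \<in> {0<..<1}) \<and>
    (\<forall>\<nu>. (\<forall>n. cmod (\<nu> n) < 1) \<longrightarrow> (\<forall>\<^sub>F n in sequentially. \<tau> n \<le> cmod (\<nu> n)) \<longrightarrow>
      (\<exists>c. (\<forall>k. c k \<noteq> 0 \<longrightarrow> k \<in> S) \<and> (\<exists>k. c k \<noteq> 0) \<and> summable (\<lambda>k. w k * (cmod (c k))\<^sup>2) \<and>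
        (\<forall>n. (\<lambda>k. c k * \<nu> n ^ k) sums 0)))"
proof -
  obtain D :: "nat \<Rightarrow> nat" and B \<tau> :: "nat \<Rightarrow> real" where D: "strict_mono D" and B: "\<And>n. 1 \<le> B n"
    and \<tau>: "\<And>n. \<tau> n \<in> {0<..<1}" and room: "\<And>n. \<exists>s. {s..s + n} \<subseteq> S \<inter> {..<D n}"
    and absorb: "\<And>n. absorbs_zero n ((1 / 2) ^ n) (D n) (B n) (D (Suc n)) (B (Suc n)) (\<tau> n)"
    using thresholds_exist by blast
  have "\<exists>c. (\<forall>k. c k \<noteq> 0 \<longrightarrow> k \<in> S) \<and> (\<exists>k. c k \<noteq> 0) \<and> summable (\<lambda>k. w k * (cmod (c k))\<^sup>2) \<and>
        (\<forall>n. (\<lambda>k. c k * \<nu> n ^ k) sums 0)"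
    if \<nu>: "\<forall>n. cmod (\<nu> n) < 1" and ev: "\<forall>\<^sub>F n in sequentially. \<tau> n \<le> cmod (\<nu> n)" for \<nu>
  proof -
    obtain N where N: "\<And>n. N \<le> n \<Longrightarrow> \<tau> n \<le> cmod (\<nu> n)"
      using ev unfolding eventually_sequentially by blast
    define P where "P n = (\<Prod>i<n. [:-\<nu> i, 1:])" for n
    have P_Suc: "P (Suc n) = P n * [:-\<nu> n, 1:]" for n by (simp add: P_def)
    \<comment> \<open>The invariant bounds the cofactor \<open>F\<close>, as
      \<open>absorbs_zero\<close> demands, and confines the support of the full polynomial.
      Nonvanishing is recorded only at the start, because frozen coefficients carry it to the
      limit.\<close>
    define A where "A i F \<longleftrightarrow> degree F < D (N + i) \<and> (\<forall>k. cmod (coeff F k) \<le> B (N + i)) \<and>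
        (\<forall>k. coeff (P (N + i) * F) k \<noteq> 0 \<longrightarrow> k \<in> S \<inter> {..<D (N + i)}) \<and> (i = 0 \<longrightarrow> F \<noteq> 0)" for i F
    define R where "R i F F' \<longleftrightarrow> (\<exists>G. P (Suc (N + i)) * F' = P (N + i) * F - G \<and>
        (\<forall>k. coeff G k \<noteq> 0 \<longrightarrow> k \<in> S \<inter> {D (N + i)..<D (Suc (N + i))}) \<and>
        wnorm w G \<le> (1 / 2) ^ i)" for i F F'
    have "\<exists>F. \<forall>i. A i (F i) \<and> R i (F i) (F (Suc i))"
    proof (rule dependent_nat_choice)
      \<comment> \<open>\<open>P N\<close> has degree \<open>N\<close>, so
        \<open>z ^ s * P N\<close> is supported in the window \<open>{s..s + N}\<close>.\<close>
      obtain s where s: "{s..s + N} \<subseteq> S \<inter> {..<D N}" using room by blast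
      have "s \<in> {s..s + N}" by simp
      then have sD: "s < D N" using s by blast
      have "k \<in> S \<inter> {..<D N}" if "coeff (P N * monom 1 s) k \<noteq> 0" for k
      proof -
        have "s \<le> k \<and> k < Suc s + N"
          by (rule coeff_mult_nonzero_range[OF _ _ that])
            (auto simp: P_def degree_prod_linear split: if_splits)
        then have "k \<in> {s..s + N}" by simp
        then show ?thesis using s by blast
      qed
      then have "A 0 (monom 1 s)"
        unfolding A_def using sD B[of N] by (auto simp: degree_monom_eq monom_eq_0_iff)
      then show "\<exists>F. A 0 F" ..
      show "\<exists>F'. A (Suc i) F' \<and> R i F F'" if F: "A i F" for F i
      proof -
        let ?n = "N + i"
        have "\<exists>F' H. F = [:-\<nu> ?n, 1:] * F' + H \<and> degree F' < D (Suc ?n) \<and>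
          (\<forall>k. cmod (coeff F' k) \<le> B (Suc ?n)) \<and>
          (\<forall>k. coeff (P ?n * H) k \<noteq> 0 \<longrightarrow> k \<in> S \<inter> {D ?n..<D (Suc ?n)}) \<and>
          wnorm w (P ?n * H) \<le> (1 / 2) ^ ?n"
          using absorb[of ?n] F N[of ?n] \<nu> unfolding absorbs_zero_def A_def P_def
          by (auto simp: less_imp_le)
        then obtain F' H where H: "F = [:-\<nu> ?n, 1:] * F' + H" "degree F' < D (Suc ?n)"
          "\<forall>k. cmod (coeff F' k) \<le> B (Suc ?n)"
          "\<forall>k. coeff (P ?n * H) k \<noteq> 0 \<longrightarrow> k \<in> S \<inter> {D ?n..<D (Suc ?n)}"
          "wnorm w (P ?n * H) \<le> (1 / 2) ^ ?n" by blast
        have eq: "P (Suc ?n) * F' = P ?n * F - P ?n * H"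
          unfolding P_Suc by (subst H(1)) (simp only: algebra_simps)
        have "(1 / 2 :: real) ^ ?n \<le> (1 / 2) ^ i" by (rule power_decreasing) auto
        with H(5) have "wnorm w (P ?n * H) \<le> (1 / 2) ^ i" by (rule order_trans)
        then have "R i F F'" unfolding R_def using eq H(4) by blast
        moreover have "k \<in> S \<inter> {..<D (Suc ?n)}" if "coeff (P (Suc ?n) * F') k \<noteq> 0" for k
        proof -
          have "coeff (P ?n * F) k \<noteq> 0 \<or> coeff (P ?n * H) k \<noteq> 0" using that by (auto simp: eq)
          moreover have "D ?n < D (Suc ?n)" using D by (simp add: strict_mono_Suc_iff)
          ultimately show ?thesis using F H(4) unfolding A_def by fastforce
        qed
        then have "A (Suc i) F'" unfolding A_def using H(2,3) by simp
        ultimately show ?thesis by blast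
      qed
    qed
    then obtain F where F: "A i (F i)" "R i (F i) (F (Suc i))" for i by blast
    define g where "g i = P (N + i) * F i" for i
    define d where "d i = D (N + i)" for i
    have "\<forall>i. \<exists>G. g (Suc i) = g i - G \<and> (\<forall>k. coeff G k \<noteq> 0 \<longrightarrow> k \<in> {d i..<d (Suc i)}) \<and>
        wnorm w G \<le> (1 / 2) ^ i"
      using F(2) unfolding R_def g_def d_def by fastforce
    then obtain G where G: "g (Suc i) = g i - G i" "coeff (G i) k \<noteq> 0 \<Longrightarrow> k \<in> {d i..<d (Suc i)}"
      "wnorm w (G i) \<le> (1 / 2) ^ i" for i k by metis
    have d: "strict_mono d" using D by (simp add: d_def strict_mono_Suc_iff)
    have g: "k \<in> S \<inter> {..<d i}" if "coeff (g i) k \<noteq> 0" for i k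
      using F(1)[of i] that unfolding A_def g_def d_def by blast
    obtain c where c: "\<And>k. c k \<noteq> 0 \<Longrightarrow> k \<in> S" "summable (\<lambda>k. w k * (cmod (c k))\<^sup>2)"
      "\<And>i k. k < d i \<Longrightarrow> c k = coeff (g i) k"
      "\<And>i z. (\<Sum>k<d i. c k * z ^ k) = poly (g i) z"
      using glue_polynomials[where w = w, OF d less_imp_le[OF w_pos] g G] by blast
    have "\<exists>k. c k \<noteq> 0"
    proof -
      have "P N \<noteq> 0" unfolding P_def using lead_coeff_prod_linear[of \<nu> N] by auto
      then have "g 0 \<noteq> 0" using F(1)[of 0] by (simp add: A_def g_def)
      then obtain k where "coeff (g 0) k \<noteq> 0" by (auto simp: poly_eq_iff)
      then have "c k \<noteq> 0" using g[of 0 k] c(3)[of k 0] by simp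
      then show ?thesis ..
    qed
    moreover have "(\<lambda>k. c k * \<nu> n ^ k) sums 0" for n
    proof -
      have sm: "summable (\<lambda>k. c k * \<nu> n ^ k)"
        using c(2) w_ge1 \<nu> by (intro summable_power_series_of_square_summable) auto
      have zero: "poly (g i) (\<nu> n) = 0" if "n < i" for i
      proof -
        have "poly (P (N + i)) (\<nu> n) = 0"
          unfolding P_def poly_prod by (rule prod_zero) (use that in \<open>auto intro!: bexI[of _ n]\<close>)
        then show ?thesis by (simp add: g_def)
      qed
      \<comment> \<open>The series converges at \<open>\<nu> n\<close>, so its sum can be computed
        along the cut-offs \<open>d i\<close>, where the partial sums vanish from
        \<open>i = Suc n\<close> on.\<close>
      have "(\<lambda>i. \<Sum>k<d i. c k * \<nu> n ^ k) \<longlonglongrightarrow> (\<Sum>k. c k * \<nu> n ^ k)"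
        using LIMSEQ_subseq_LIMSEQ[OF summable_LIMSEQ[OF sm] d] by (simp add: o_def)
      moreover have "(\<lambda>i. \<Sum>k<d i. c k * \<nu> n ^ k) \<longlonglongrightarrow> 0"
        unfolding c(4) using zero
        by (intro tendsto_eventually eventually_sequentiallyI[of "Suc n"]) auto
      ultimately have "(\<Sum>k. c k * \<nu> n ^ k) = 0" by (rule LIMSEQ_unique)
      then show ?thesis using summable_sums[OF sm] by simp
    qed
    ultimately show ?thesis using c(1,2) by blast
  qed
  then show ?thesis using \<tau> by blast
qed

end

section \<open>Growth of weights along progressions; monotone thresholds\<close>

text \<open>The quantity under the logarithm telescopes as a product of factors
  \<open>1 + 1 / (A + j)\<close>, and \<open>ln (1 + x) \<le> x\<close>.\<close>

lemma ln_le_sum_inverse: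
  fixes A :: real
  assumes "0 < A"
  shows "ln (1 + real l / A) \<le> (\<Sum>j<l. 1 / (A + real j))"
proof (induction l)
  case (Suc l)
  have pos: "0 < A + real l" using assms by simp
  have pos': "0 < 1 + real l / A" "0 < 1 + 1 / (A + real l)"
    using assms pos by (auto intro!: add_pos_nonneg)
  have "1 + real (Suc l) / A = (A + real l + 1) / A" using assms by (simp add: field_simps)
  also have "\<dots> = ((A + real l) / A) * ((A + real l + 1) / (A + real l))" using pos by simp
  also have "\<dots> = (1 + real l / A) * (1 + 1 / (A + real l))"
    using assms pos by (simp add: add_divide_distrib)
  finally have "ln (1 + real (Suc l) / A) = ln (1 + real l / A) + ln (1 + 1 / (A + real l))"
    by (simp only: ln_mult_pos[OF pos'])
  also have "ln (1 + 1 / (A + real l)) \<le> 1 / (A + real l)"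
    using pos by (intro ln_add_one_self_le_self) auto
  finally show ?case using Suc by simp
qed simp

lemma powr_le_linear:
  assumes "1 \<le> x" and "0 \<le> (\<alpha>::real)" and "\<alpha> \<le> 1"
  shows "x powr \<alpha> \<le> x"
  using powr_mono[OF assms(3,1)] assms(1) by simp

text \<open>The factor \<open>real q + 1\<close> absorbs the step length. For the rest,
  \<open>(a + j) powr \<alpha>\<close> is
  \<open>a powr \<alpha> * (1 + j / a) powr \<alpha>\<close>, at most
  \<open>a powr \<alpha> + j * (a powr \<alpha> / a)\<close>, and
  \<open>a powr \<alpha> \<le> a\<close>.\<close>

lemma progression_weight_le:
  fixes a j q :: nat
  assumes "0 \<le> \<alpha>" and "\<alpha> \<le> 1" and "1 \<le> a" and "1 \<le> q"
  shows "(real (a + j * q) + 1) powr \<alpha> \<le> (real q + 1) * (real a powr \<alpha> + real j)"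
proof -
  have "real (a + j * q) + 1 \<le> (real q + 1) * (real a + real j)"
  proof -
    have "1 * 1 \<le> real q * real a" using assms(3,4) by (intro mult_mono) auto
    then show ?thesis by (simp add: algebra_simps)
  qed
  then have "(real (a + j * q) + 1) powr \<alpha> \<le> ((real q + 1) * (real a + real j)) powr \<alpha>"
    using assms by (intro powr_mono2) auto
  also have "\<dots> = (real q + 1) powr \<alpha> * (real a + real j) powr \<alpha>"
    by (rule powr_mult)
  also have "(real q + 1) powr \<alpha> \<le> real q + 1"
    using assms by (intro powr_le_linear) auto
  also have "(real a + real j) powr \<alpha> \<le> real a powr \<alpha> + real j"
  proof -
    have "real a + real j = real a * (1 + real j / real a)" using assms(3) by (simp add: field_simps)
    then have "(real a + real j) powr \<alpha> = real a powr \<alpha> * (1 + real j / real a) powr \<alpha>"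
      by (simp add: powr_mult)
    also have "\<dots> \<le> real a powr \<alpha> * (1 + real j / real a)"
      using assms by (intro mult_left_mono powr_le_linear) auto
    also have "\<dots> = real a powr \<alpha> + real j * (real a powr \<alpha> / real a)"
      by (simp add: algebra_simps)
    also have "real a powr \<alpha> / real a \<le> 1"
      using powr_le_linear[of "real a" \<alpha>] assms by (simp add: divide_le_eq)
    finally show ?thesis by (simp add: mult_left_mono)
  qed
  finally show ?thesis by (simp add: mult_left_mono mult_right_mono)
qed

text \<open>The products of the gaps \<open>1 - \<sigma> i\<close> for \<open>i \<le> n\<close>
  decrease strictly, stay positive and lie below the last gap; \<open>t n\<close> is 1 minus this
  product.\<close>

lemma strict_mono_majorant:
  fixes \<sigma> :: "nat \<Rightarrow> real"
  assumes "\<And>n. \<sigma> n \<in> {0<..<1}"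
  obtains t where "strict_mono t" and "\<And>n. \<sigma> n \<le> t n" and "\<And>n. t n \<in> {0<..<1}"
proof
  define p where "p n = (\<Prod>i\<le>n. (1 - \<sigma> i))" for n
  have p0: "0 < p n" for n unfolding p_def using assms by (intro prod_pos) auto
  have p_Suc: "p (Suc n) = p n * (1 - \<sigma> (Suc n))" for n by (simp add: p_def)
  have p_less: "p (Suc n) < p n" for n
    using p0[of n] assms[of "Suc n"] by (simp add: p_Suc)
  have p_le: "p n \<le> 1 - \<sigma> n" for n
  proof (cases n)
    case (Suc m)
    have "p m \<le> 1" unfolding p_def using assms by (intro prod_le_1) (auto simp: less_imp_le)
    then have "p m * (1 - \<sigma> n) \<le> 1 * (1 - \<sigma> n)"
      using assms[of n] by (intro mult_right_mono) auto
    then show ?thesis by (simp add: Suc p_Suc)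
  qed (simp add: p_def)
  show "strict_mono (\<lambda>n. 1 - p n)" using p_less by (simp add: strict_mono_Suc_iff)
  show "\<sigma> n \<le> 1 - p n" for n using p_le[of n] by simp
  show "1 - p n \<in> {0<..<1}" for n using p0[of n] p_le[of n] assms[of n] by simp
qed

section \<open>From the power series to a function in the space\<close>

text \<open>The witness is \<open>z ^ r * g (z ^ q)\<close>, where \<open>g\<close> has coefficients
  \<open>c\<close>. Its coefficients sit at the positions \<open>r + q * m\<close>, and zeros of
  \<open>g\<close> at \<open>z ^ q\<close> become zeros at \<open>z\<close>.\<close>

lemma not_uniqueness_pairI:
  assumes sm: "summable (\<lambda>m. (real (r + q * m) + 1) powr \<alpha> * (cmod (c m))\<^sup>2)"
    and "0 \<le> \<alpha>" and "0 < q" and "r < q"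
    and supp: "\<And>m. c m \<noteq> 0 \<Longrightarrow> r + q * m \<in> \<N>" and nz: "c m0 \<noteq> 0"
    and zeros: "\<And>z. z \<in> \<Lambda> \<Longrightarrow> cmod z < 1 \<and> (\<lambda>m. c m * (z ^ q) ^ m) sums 0"
  shows "\<not> uniqueness_pair \<alpha> \<Lambda> \<N>"
proof
  assume uniq: "uniqueness_pair \<alpha> \<Lambda> \<N>"
  define b where "b k = (if k mod q = r then c (k div q) else 0)" for k
  define f where "f = eval_fps (Abs_fps b)"
  have mono: "strict_mono (\<lambda>m. r + q * m)" using assms(3) by (simp add: strict_mono_Suc_iff)
  have b: "b (r + q * m) = c m" for m using assms(3,4) by (simp add: b_def)
  have b0: "b k = 0" if "k \<notin> range (\<lambda>m. r + q * m)" for k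
  proof (rule ccontr)
    assume "b k \<noteq> 0"
    then have "k mod q = r" by (auto simp: b_def split: if_splits)
    then have "k = r + q * (k div q)" using mod_mult_div_eq[of k q] by simp
    then show False using that by blast
  qed
  have sm_b: "summable (\<lambda>k. (real k + 1) powr \<alpha> * (cmod (b k))\<^sup>2)"
    by (subst summable_mono_reindex[OF mono, symmetric]) (use b0 sm in \<open>auto simp: b\<close>)
  have "1 \<le> fps_conv_radius (Abs_fps b)"
    unfolding fps_conv_radius_def
  proof (rule conv_radius_geI_ex)
    fix x :: real assume x: "0 < x" "ereal x < 1"
    have "summable (\<lambda>k. b k * of_real x ^ k)"
      using x assms(2)
      by (intro summable_power_series_of_square_summable[OF sm_b]) (auto intro!: ge_one_powr_ge_zero)
    then show "\<exists>z. norm z = x \<and> summable (\<lambda>k. fps_nth (Abs_fps b) k * z ^ k)"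
      using x by (intro exI[of _ "of_real x"]) auto
  qed
  then have ball: "ball 0 1 \<subseteq> eball 0 (fps_conv_radius (Abs_fps b))"
    by (auto simp: in_eball_iff intro!: less_le_trans[of _ 1 "fps_conv_radius (Abs_fps b)"])
  have f_exp: "f has_fps_expansion Abs_fps b"
    unfolding f_def using \<open>1 \<le> _\<close>
    by (intro eval_fps_has_fps_expansion) (auto intro: less_le_trans[of 0 1])
  have coeff: "taylor_coeff f k = b k" for k
    using fps_expansion_eqI[OF f_exp] by simp
  have "f analytic_on ball 0 1" unfolding f_def by (rule FPS_Convergence.analytic_on_eval_fps) (fact ball)
  then have "f \<in> dirichlet_type_space \<alpha>"
    using sm_b by (simp add: dirichlet_type_space_def coeff)
  moreover have "f z = 0" if "z \<in> \<Lambda>" for z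
  proof -
    have "(\<lambda>m. c m * (z ^ q) ^ m) sums 0" using zeros[OF that] by blast
    then have "(\<lambda>m. z ^ r * (c m * (z ^ q) ^ m)) sums (z ^ r * 0)" by (rule sums_mult)
    then have "(\<lambda>m. b (r + q * m) * z ^ (r + q * m)) sums 0"
      by (simp only: b power_add power_mult mult.left_commute mult_zero_right)
    then have "(\<lambda>k. b k * z ^ k) sums 0"
      by (subst (asm) sums_mono_reindex[OF mono]) (use b0 in auto)
    then show ?thesis by (simp add: f_def eval_fps_def sums_iff)
  qed
  moreover have "taylor_coeff f k = 0" if "k \<notin> \<N>" for k
    proof (cases "k \<in> range (\<lambda>m. r + q * m)")
    case True
    then obtain m where "k = r + q * m" by blast
    then show ?thesis using that supp[of m] b[of m] coeff[of k] by auto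
  next
    case False
    then show ?thesis unfolding coeff by (rule b0)
  qed
  ultimately have "f z = 0" if "z \<in> ball 0 1" for z
    using uniq that unfolding uniqueness_pair_def by blast
  then have "fps_expansion f 0 = fps_expansion (\<lambda>_. 0) 0"
    by (intro fps_expansion_cong) (auto intro!: eventually_nhds_in_open[of "ball 0 1", THEN eventually_mono])
  then have "taylor_coeff f (r + q * m0) = 0" by (simp add: fps_expansion_def)
  then show False using nz by (simp only: coeff b)
qed

section \<open>Choice of residue class, blocks and thresholds\<close>

theorem theorem1p1:
  fixes \<alpha> :: real and a l :: "nat \<Rightarrow> nat" and \<N> :: "nat set" and q :: nat
  assumes "0 \<le> \<alpha>" and "\<alpha> \<le> 1"
    and "\<And>k. k \<ge> 1 \<Longrightarrow> a k > 0" and "\<And>k. k \<ge> 1 \<Longrightarrow> l k > 0"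
    and "filterlim (\<lambda>k. real (l k) / real (a k) powr \<alpha>) at_top sequentially"
    and "q > 0"
    and "\<And>k. k \<ge> 1 \<Longrightarrow> {a k + j * q |j. j < l k} \<subseteq> \<N>"
  shows "\<exists>t :: nat \<Rightarrow> real.
           strict_mono_on {1..} t \<and> (\<forall>k\<ge>1. t k \<in> {0<..<1}) \<and>
           (\<forall>\<xi> :: nat \<Rightarrow> complex.
              \<xi> ` {1..} \<subseteq> ball 0 1 \<and> (\<forall>\<^sub>F k in sequentially. cmod (\<xi> k) \<ge> t k)
              \<longrightarrow> \<not> uniqueness_pair \<alpha> (\<xi> ` {1..}) \<N>)"
proof -
  \<comment> \<open>Pigeonhole: otherwise each of the finitely many residues, hence all of them at
    once, would be avoided eventually.\<close>
  have "\<exists>r<q. \<exists>\<^sub>F k in sequentially. a k mod q = r"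
  proof (rule ccontr)
    assume "\<not> ?thesis"
    then have "\<forall>r\<in>{..<q}. \<forall>\<^sub>F k in sequentially. a k mod q \<noteq> r"
      by (auto simp: not_frequently)
    then have "\<forall>\<^sub>F k in sequentially. \<forall>r\<in>{..<q}. a k mod q \<noteq> r"
      by (intro eventually_ball_finite) auto
    then have "\<forall>\<^sub>F k :: nat in sequentially. False"
      by (rule eventually_mono) (use assms(6) in auto)
    then show False by simp
  qed
  then obtain r where r: "r < q" "\<exists>\<^sub>F k in sequentially. a k mod q = r" by blast
  define w where "w m = (real (r + q * m) + 1) powr \<alpha>" for m
  define S where "S = {m. r + q * m \<in> \<N>}"
  have w1: "1 \<le> w m" for m unfolding w_def using assms(1) by (intro ge_one_powr_ge_zero) auto
  have blocks: "\<exists>s e. D \<le> s \<and> {s..<e} \<subseteq> S \<and> M \<le> (\<Sum>m\<in>{s..<e}. 1 / w m)" for D M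
  proof -
    have "filterlim (\<lambda>k. ln (1 + real (l k) / real (a k) powr \<alpha>)) at_top sequentially"
      by (intro filterlim_compose[OF ln_at_top] filterlim_tendsto_add_at_top[OF tendsto_const] assms(5))
    \<comment> \<open>The factor \<open>real q + 1\<close> compensates the one in
      \<open>progression_weight_le\<close>; the extra \<open>D\<close> pays for discarding indices
      below \<open>D\<close>, each contributing at most 1. Thus a block may start early and still be
      used beyond \<open>D\<close>.\<close>
    then have "\<forall>\<^sub>F k in sequentially.
        (real q + 1) * (M + real D) \<le> ln (1 + real (l k) / real (a k) powr \<alpha>)"
      unfolding filterlim_at_top by blast
    then have "\<exists>\<^sub>F k in sequentially. a k mod q = r \<and> 1 \<le> k \<and>
        (real q + 1) * (M + real D) \<le> ln (1 + real (l k) / real (a k) powr \<alpha>)"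
      by (intro frequently_eventually_frequently[OF r(2)] eventually_conj eventually_ge_at_top)
    then obtain k where k: "a k mod q = r" "1 \<le> k"
      "(real q + 1) * (M + real D) \<le> ln (1 + real (l k) / real (a k) powr \<alpha>)"
      using frequently_ex by blast
    define m where "m = a k div q"
    have ak: "a k = r + q * m" using k(1) mod_mult_div_eq[of "a k" q] by (simp add: m_def)
    have a1: "1 \<le> a k" using assms(3)[OF k(2)] by simp
    have in_S: "{m..<m + l k} \<subseteq> S"
    proof
      fix i assume i: "i \<in> {m..<m + l k}"
      then have "r + q * i = a k + (i - m) * q"
        by (simp add: ak algebra_simps flip: distrib_left)
      moreover have "i - m < l k" using i by auto
      ultimately have "r + q * i \<in> \<N>" using assms(7)[OF k(2)] by auto
      then show "i \<in> S" by (simp add: S_def)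
    qed
    have "(real q + 1) * (M + real D) \<le> (\<Sum>j<l k. 1 / (real (a k) powr \<alpha> + real j))"
      using k(3) a1 by (intro order_trans[OF _ ln_le_sum_inverse]) auto
    also have "\<dots> \<le> (\<Sum>j<l k. (real q + 1) * (1 / w (m + j)))"
    proof (rule sum_mono)
      fix j
      have "w (m + j) \<le> (real q + 1) * (real (a k) powr \<alpha> + real j)"
        using progression_weight_le[OF assms(1,2) a1, of q j] assms(6)
        by (simp add: w_def ak algebra_simps)
      moreover have "0 < real (a k) powr \<alpha> + real j" using a1 by (simp add: add_pos_nonneg)
      ultimately show "1 / (real (a k) powr \<alpha> + real j) \<le> (real q + 1) * (1 / w (m + j))"
        using w1[of "m + j"] by (simp add: field_simps)
    qed
    also have "\<dots> = (real q + 1) * (\<Sum>j<l k. 1 / w (m + j))"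
      by (simp only: sum_distrib_left)
    finally have "M + real D \<le> (\<Sum>j<l k. 1 / w (m + j))"
      by (simp add: mult_le_cancel_left)
    also have "\<dots> = (\<Sum>i\<in>{m..<m + l k}. 1 / w i)"
      using sum.shift_bounds_nat_ivl[of "\<lambda>i. 1 / w i" 0 m "l k"]
      by (simp add: atLeast0LessThan add.commute)
    also have "\<dots> \<le> (\<Sum>i\<in>{..<D} \<union> {max m D..<m + l k}. 1 / w i)"
      using w1 by (intro sum_mono2) (auto intro: order_trans[OF zero_le_one])
    also have "\<dots> = (\<Sum>i<D. 1 / w i) + (\<Sum>i\<in>{max m D..<m + l k}. 1 / w i)"
      by (intro sum.union_disjoint) auto
    also have "(\<Sum>i<D. 1 / w i) \<le> (\<Sum>i<D. 1)"
      using w1 by (intro sum_mono) (auto simp: divide_le_eq_1 intro: less_le_trans[OF zero_less_one])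
    finally have "M \<le> (\<Sum>i\<in>{max m D..<m + l k}. 1 / w i)" by simp
    moreover have "{max m D..<m + l k} \<subseteq> S" using in_S by auto
    ultimately show ?thesis by (intro exI[of _ "max m D"] exI[of _ "m + l k"]) auto
  qed
  have w_Suc: "w (Suc m) \<le> (real q + 1) * w m" for m
  proof -
    have "w (Suc m) \<le> ((real q + 1) * (real (r + q * m) + 1)) powr \<alpha>"
      unfolding w_def using assms(1) by (intro powr_mono2) (auto simp: algebra_simps)
    also have "\<dots> = (real q + 1) powr \<alpha> * w m" unfolding w_def by (rule powr_mult)
    also have "\<dots> \<le> (real q + 1) * w m"
      using w1[of m] assms by (intro mult_right_mono powr_le_linear) auto
    finally show ?thesis .
  qed
  interpret divergent_blocks w "real q + 1" S
    by unfold_locales (fact w1 w_Suc blocks)+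
  obtain \<tau> where \<tau>: "\<And>n. \<tau> n \<in> {0<..<1}"
    and series: "\<And>\<nu>. (\<forall>n. cmod (\<nu> n) < 1) \<Longrightarrow> (\<forall>\<^sub>F n in sequentially. \<tau> n \<le> cmod (\<nu> n)) \<Longrightarrow>
      (\<exists>c. (\<forall>k. c k \<noteq> 0 \<longrightarrow> k \<in> S) \<and> (\<exists>k. c k \<noteq> 0) \<and> summable (\<lambda>k. w k * (cmod (c k))\<^sup>2) \<and>
        (\<forall>n. (\<lambda>k. c k * \<nu> n ^ k) sums 0))"
    using nonzero_power_series_with_zeros by blast
  \<comment> \<open>The zeros of \<open>g\<close> are prescribed at \<open>q\<close>-th powers of
    the points, so the thresholds pass through a \<open>q\<close>-th root.\<close>
  have "root q (\<tau> n) \<in> {0<..<1}" for n using \<tau>[of n] assms(6) by simp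
  then obtain t where t: "strict_mono t" "\<And>n. root q (\<tau> n) \<le> t n" "\<And>n. t n \<in> {0<..<1}"
    using strict_mono_majorant[of "\<lambda>n. root q (\<tau> n)"] by blast
  show ?thesis
  \<comment> \<open>The points are indexed from 1 and \<open>t\<close> from 0, hence
    \<open>k - 1\<close>.\<close>
  proof (intro exI[of _ "\<lambda>k. t (k - 1)"] conjI allI impI)
    show "strict_mono_on {1..} (\<lambda>k. t (k - 1))"
      using t(1) by (auto simp: strict_mono_on_def strict_mono_def)
    show "t (k - 1) \<in> {0<..<1}" for k by (rule t(3))
    fix \<xi> :: "nat \<Rightarrow> complex"
    assume \<xi>: "\<xi> ` {1..} \<subseteq> ball 0 1 \<and> (\<forall>\<^sub>F k in sequentially. cmod (\<xi> k) \<ge> t (k - 1))"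
    \<comment> \<open>Distinct points may share a \<open>q\<close>-th power; repeated values of
      \<open>\<nu>\<close> are allowed in the construction.\<close>
    define \<nu> where "\<nu> n = \<xi> (Suc n) ^ q" for n
    have \<xi>1: "cmod (\<xi> (Suc n)) < 1" for n using \<xi> by (auto simp: image_subset_iff)
    have "\<forall>n. cmod (\<nu> n) < 1"
      using \<xi>1 assms(6) by (simp add: \<nu>_def norm_power power_less_one_iff)
    moreover have "\<forall>\<^sub>F n in sequentially. \<tau> n \<le> cmod (\<nu> n)"
    proof -
      have "\<forall>\<^sub>F n in sequentially. cmod (\<xi> (Suc n)) \<ge> t n"
        using \<xi> eventually_sequentially_Suc[of "\<lambda>k. cmod (\<xi> k) \<ge> t (k - 1)"] by simp
      then show ?thesis
      proof (rule eventually_mono)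
        fix n assume "t n \<le> cmod (\<xi> (Suc n))"
        then have "root q (\<tau> n) ^ q \<le> cmod (\<xi> (Suc n)) ^ q"
          using t(2)[of n] \<tau>[of n] by (intro power_mono real_root_ge_zero) auto
        then show "\<tau> n \<le> cmod (\<nu> n)"
          using \<tau>[of n] assms(6) by (simp add: \<nu>_def norm_power)
      qed
    qed
    ultimately obtain c m0 where c: "\<And>k. c k \<noteq> 0 \<Longrightarrow> k \<in> S" "c m0 \<noteq> 0"
      "summable (\<lambda>k. w k * (cmod (c k))\<^sup>2)" "\<And>n. (\<lambda>k. c k * \<nu> n ^ k) sums 0"
      using series[of \<nu>] by blast
    show "\<not> uniqueness_pair \<alpha> (\<xi> ` {1..}) \<N>"
    proof (rule not_uniqueness_pairI[OF c(3)[unfolded w_def] assms(1,6) r(1) _ c(2)])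
      show "r + q * m \<in> \<N>" if "c m \<noteq> 0" for m using c(1)[OF that] by (simp add: S_def)
      fix z assume "z \<in> \<xi> ` {1..}"
      then obtain n where "z = \<xi> (Suc n)"
        by (metis Suc_le_D atLeast_iff imageE One_nat_def)
      then show "cmod z < 1 \<and> (\<lambda>m. c m * (z ^ q) ^ m) sums 0"
        using c(4)[of n] \<xi>1[of n] by (simp add: \<nu>_def)
    qed
  qed
qed

end
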